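(* Let $d=1$, let $N_p\ge1$ be an integer, $X_t^1,\dots,X_t^{N_p}\in\mathbb{R}$, $\epsilon>0$, and let $h(x)=\sum_{k=0}^p a_kH_k(x)$ be a polynomial of degree $p\ge1$, where $H_k$ is the Hermite polynomial of degree $k$. For each $i=1,\dots,N_p$ define coefficients $\hat K_k^i$ by the backward recursion $$\hat K_k^i=2\epsilon a_{k+1}+2(2\epsilon-1)(k+2)\hat K_{k+2}^i+2X_t^i\hat K_{k+1}^i,\qquad k=p-1,\dots,1,0,$$ with initial values $\hat K_p^i=\hat K_{p+1}^i=0$, and define the constant $$C^i:=a_0+\frac{X_t^i}{\epsilon}\hat K_0^i+\left(2-\frac1\epsilon\right)\hat K_1^i.$$ Then the exact solution to $$\left(p_t^{N_p,\epsilon}(x)K(x)\right)'=-\left(h(x)-\hat h^{N_p}\right)p_t^{N_p,\epsilon}(x),\qquad x\in\mathbb{R},$$ subject to the boundary condition $$\lim_{x\to-\infty}p_t^{N_p,\epsilon}(x)K(x)=\lim_{x\to+\infty}p_t^{N_p,\epsilon}(x)K(x)=0,$$ is given by $$K(x)=\frac{1}{\sum_{i=1}^{N_p}\mathcal{N}(x;X_t^i,\epsilon)}\sum_{i=1}^{N_p}\left[\mathcal{N}(x;X_t^i,\epsilon)\sum_{l=0}^{p-1}\hat K_l^iH_l(x)+\frac{\hat h^{N_p}-C^i}{2}\,\mathrm{erf}\left(\frac{x-X_t^i}{\sqrt{2\epsilon}}\right)\right].$$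
   Context: $\mathcal{N}(x;X_t^i,\epsilon)=\frac{1}{\sqrt{2\pi\epsilon}}\exp\left\{-\frac{(x-X_t^i)^2}{2\epsilon}\right\}$ is the Gaussian density with mean $X_t^i$ and variance $\epsilon$; $p_t^{N_p,\epsilon}(x)=\frac1{N_p}\sum_{i=1}^{N_p}\mathcal{N}(x;X_t^i,\epsilon)$; $\hat h^{N_p}=\int_{\mathbb{R}}h(x)\,p_t^{N_p,\epsilon}(x)\,dx$. The Hermite polynomials are the physicists' ones: $H_0(x)=1$, $H_1(x)=2x$, $H_{n+1}(x)=2xH_n(x)-2nH_{n-1}(x)$. The error function is $\mathrm{erf}(x)=\frac{2}{\sqrt\pi}\int_0^xe^{-\eta^2}d\eta$. The time $t$ is fixed and prime denotes $d/dx$. *)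

theory Defs
  imports "HOL-Probability.Probability" "HOL-Computational_Algebra.Polynomial"
begin

text \<open>The library's \<^const>\<open>normal_density\<close> is parametrised by the standard deviation,
  hence the square root of the variance below.\<close>

definition gauss :: "real \<Rightarrow> real \<Rightarrow> real \<Rightarrow> real" where
  "gauss \<mu> \<epsilon> x = normal_density \<mu> (sqrt \<epsilon>) x"

lemma gauss_eq:
  assumes "\<epsilon> > 0"
  shows "gauss \<mu> \<epsilon> x = 1 / sqrt (2 * pi * \<epsilon>) * exp (- ((x - \<mu>)\<^sup>2 / (2 * \<epsilon>)))"
  using assms by (simp add: gauss_def normal_density_def)

definition particle_density :: "nat \<Rightarrow> (nat \<Rightarrow> real) \<Rightarrow> real \<Rightarrow> real \<Rightarrow> real" where
  "particle_density N X \<epsilon> x = 1 / real N * (\<Sum>i = 1..N. gauss (X i) \<epsilon> x)"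

definition particle_mean :: "nat \<Rightarrow> (nat \<Rightarrow> real) \<Rightarrow> real \<Rightarrow> real poly \<Rightarrow> real" where
  "particle_mean N X \<epsilon> h = (LBINT x. poly h x * particle_density N X \<epsilon> x)"

text \<open>Physicists' convention.\<close>

fun hermite :: "nat \<Rightarrow> real poly" where
  "hermite 0 = 1"
| "hermite (Suc 0) = [:0, 2:]"
| "hermite (Suc (Suc n)) = [:0, 2:] * hermite (Suc n) - smult (2 * real (Suc n)) (hermite n)"

text \<open>The interval integral is oriented, so \<open>x < 0\<close> is covered.\<close>

definition erf :: "real \<Rightarrow> real" where
  "erf x = 2 / sqrt pi * (LBINT \<eta>=ereal 0..ereal x. exp (- (\<eta>\<^sup>2)))"

text \<open>Backward recursion for \<open>k = p-1, \<dots>, 0\<close> started from the value \<open>0\<close> at \<open>p\<close> and \<open>p+1\<close>;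
  \<open>\<xi>\<close> is the particle position.\<close>

function gain_coeff :: "real \<Rightarrow> (nat \<Rightarrow> real) \<Rightarrow> nat \<Rightarrow> real \<Rightarrow> nat \<Rightarrow> real" where
  "gain_coeff \<epsilon> a p \<xi> k =
     (if p \<le> k then 0
      else 2 * \<epsilon> * a (k + 1)
           + 2 * (2 * \<epsilon> - 1) * real (k + 2) * gain_coeff \<epsilon> a p \<xi> (k + 2)
           + 2 * \<xi> * gain_coeff \<epsilon> a p \<xi> (k + 1))"
  by pat_completeness auto
termination
  by (relation "Wellfounded.measure (\<lambda>(\<epsilon>, a, p, \<xi>, k). p - k)") auto

declare gain_coeff.simps [simp del]

definition gain_const :: "real \<Rightarrow> (nat \<Rightarrow> real) \<Rightarrow> nat \<Rightarrow> real \<Rightarrow> real" where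
  "gain_const \<epsilon> a p \<xi> =
     a 0 + \<xi> / \<epsilon> * gain_coeff \<epsilon> a p \<xi> 0 + (2 - 1 / \<epsilon>) * gain_coeff \<epsilon> a p \<xi> 1"

definition solves_gain_bvp ::
    "nat \<Rightarrow> (nat \<Rightarrow> real) \<Rightarrow> real \<Rightarrow> real poly \<Rightarrow> (real \<Rightarrow> real) \<Rightarrow> bool" where
  "solves_gain_bvp N X \<epsilon> h K \<longleftrightarrow>
     (\<forall>x. ((\<lambda>y. particle_density N X \<epsilon> y * K y) has_real_derivative
             - (poly h x - particle_mean N X \<epsilon> h) * particle_density N X \<epsilon> x) (at x)) \<and>
     ((\<lambda>x. particle_density N X \<epsilon> x * K x) \<longlongrightarrow> 0) at_bot \<and>
     ((\<lambda>x. particle_density N X \<epsilon> x * K x) \<longlongrightarrow> 0) at_top"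

end

theory Submission
  imports Defs "HOL-Real_Asymp.Real_Asymp"
begin

text \<open>For a particle at \<open>\<xi>\<close> with Gaussian density \<open>g\<close>, one has
  \<open>(P g)' = (P' - (x - \<xi>) / \<epsilon> * P) g\<close> for every polynomial \<open>P\<close>. With \<open>P = \<Sum>\<^sub>l K\<^sub>l H\<^sub>l\<close>, comparing
  Hermite coefficients shows that the backward recursion is exactly the condition
  \<open>(P g)' = (C - h) g\<close>, and the error function supplies the antiderivative of the remaining
  multiple of \<open>g\<close>. Integrating \<open>(P g)' = (C - h) g\<close> over the line gives \<open>C = \<integral> h g\<close>, so the mean
  of the constants \<open>C\<^sup>i\<close> is the particle mean of \<open>h\<close>; hence the limits of the error function
  terms at infinity cancel in the sum over the particles. Uniqueness holds because the
  difference of two solutions, multiplied by the density, is constant and vanishes at infinity.\<close>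

section \<open>Hermite polynomials and the backward recursion\<close>

lemma times_hermite:
  "x * poly (hermite n) x = poly (hermite (Suc n)) x / 2 + real n * poly (hermite (n - 1)) x"
  \<comment> \<open>At \<open>n = 0\<close> the truncated index \<open>n - 1\<close> is harmless,
    because its factor \<open>real n\<close> vanishes.\<close>
  by (cases n) (simp_all add: field_simps)

lemma pderiv_hermite: "pderiv (hermite n) = smult (2 * real n) (hermite (n - 1))"
proof (induction n rule: hermite.induct)
  case (3 n)
  show ?case
  proof (intro poly_ext)
    fix x
    have "poly (pderiv (hermite (Suc (Suc n)))) x =
        2 * poly (hermite (Suc n)) x + 4 * real (Suc n) * (x * poly (hermite n) x)
        - 4 * real (Suc n) * (real n * poly (hermite (n - 1)) x)"
      by (simp add: pderiv_mult pderiv_pCons pderiv_smult pderiv_diff 3 algebra_simps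
          del: hermite.simps(2))
    \<comment> \<open>Expanding x H_n cancels the H_{n-1} terms and raises the factor of H_{n+1}
      from 2 to 2 (n + 2).\<close>
    also have "\<dots> = poly (smult (2 * real (Suc (Suc n))) (hermite (Suc (Suc n) - 1))) x"
      unfolding times_hermite by (simp add: algebra_simps)
    finally show "poly (pderiv (hermite (Suc (Suc n)))) x = \<dots>" .
  qed
qed (simp_all add: pderiv_pCons)

text \<open>With the Gaussian factor removed, this is a polynomial identity. In the Hermite basis,
  the coefficients of degree at least 1 match by the recursion, and the one of degree 0 on the left
  is the constant minus \<open>a 0\<close>.\<close>

lemma gain_ode:
  fixes a :: "nat \<Rightarrow> real" and \<epsilon> \<xi> x :: real and p :: nat
  defines "c \<equiv> gain_coeff \<epsilon> a p \<xi>"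
  defines "P \<equiv> \<Sum>l<p. smult (c l) (hermite l)"
  assumes "\<epsilon> > 0"
  shows "poly (pderiv P) x - (x - \<xi>) / \<epsilon> * poly P x =
    gain_const \<epsilon> a p \<xi> - poly (\<Sum>k\<le>p. smult (a k) (hermite k)) x"
proof -
  define H where "H l = poly (hermite l) x" for l
  \<comment> \<open>Vanishing from index \<open>p\<close> on lets the sums below be lengthened at no
    cost.\<close>
  have c0: "c l = 0" if "p \<le> l" for l
    using that by (simp add: c_def gain_coeff.simps)
  \<comment> \<open>The recursion is solved for the coefficient of H_{l+1} in h.\<close>
  have c_rec: "a (Suc l) = c l / (2 * \<epsilon>) - (2 - 1 / \<epsilon>) * (real l + 2) * c (l + 2) - \<xi> / \<epsilon> * c (Suc l)"
    if "l < p" for l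
  proof -
    have "c l = 2 * \<epsilon> * a (l + 1) + 2 * (2 * \<epsilon> - 1) * real (l + 2) * c (l + 2) + 2 * \<xi> * c (l + 1)"
      unfolding c_def using that by (subst gain_coeff.simps) simp
    then show ?thesis
      using \<open>\<epsilon> > 0\<close> by (simp add: field_simps)
  qed
  \<comment> \<open>Reindexing to \<open>H (Suc l)\<close>: the terms \<open>p\<close> and
    \<open>p + 1\<close> are added as zeros, then the terms 0 and 1 are split off. The former
    vanishes through its factor \<open>l\<close>, the latter is \<open>c 1 * H 0\<close>.\<close>
  have low: "(\<Sum>l<p. c l * (real l * H (l - 1))) = (\<Sum>l<p. c (l + 2) * (real l + 2) * H (Suc l)) + c 1"
  proof -
    have "(\<Sum>l<p. c l * (real l * H (l - 1))) = (\<Sum>l<Suc (Suc p). c l * (real l * H (l - 1)))"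
      by (simp add: c0)
    also have "\<dots> = (\<Sum>l<p. c (l + 2) * (real l + 2) * H (Suc l)) + c 1 * H 0"
      by (subst sum.lessThan_Suc_shift, subst sum.lessThan_Suc_shift)
        (simp add: algebra_simps)
    finally show ?thesis by (simp add: H_def)
  qed
  have mid: "(\<Sum>l<p. c l * H l) = (\<Sum>l<p. c (Suc l) * H (Suc l)) + c 0"
  proof -
    have "(\<Sum>l<p. c l * H l) = (\<Sum>l<Suc p. c l * H l)"
      by (simp add: c0)
    also have "\<dots> = (\<Sum>l<p. c (Suc l) * H (Suc l)) + c 0 * H 0"
      by (subst sum.lessThan_Suc_shift) simp
    finally show ?thesis by (simp add: H_def)
  qed
  have "poly (pderiv P) x - (x - \<xi>) / \<epsilon> * poly P x =
    (\<Sum>l<p. c l * (2 * real l * H (l - 1)) - c l * ((x * H l - \<xi> * H l) / \<epsilon>))"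
    by (simp add: P_def H_def higher_pderiv_sum[of 1, simplified] pderiv_smult pderiv_hermite poly_sum
        sum_subtractf sum.distrib sum_distrib_left algebra_simps sum_divide_distrib diff_divide_distrib)
  \<comment> \<open>The factor \<open>2 - 1 / \<epsilon>\<close> joins 2 from the derivative of H_l
    with -1/\<epsilon> from the H_{l-1} part of x H_l.\<close>
  also have "\<dots> = (\<Sum>l<p. (2 - 1 / \<epsilon>) * (c l * (real l * H (l - 1)))
      - c l * H (Suc l) / (2 * \<epsilon>) + \<xi> / \<epsilon> * (c l * H l))"
  proof (intro sum.cong refl)
    fix l
    have "x * H l = H (Suc l) / 2 + real l * H (l - 1)"
      unfolding H_def by (rule times_hermite)
    then show "c l * (2 * real l * H (l - 1)) - c l * ((x * H l - \<xi> * H l) / \<epsilon>) =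
        (2 - 1 / \<epsilon>) * (c l * (real l * H (l - 1))) - c l * H (Suc l) / (2 * \<epsilon>) + \<xi> / \<epsilon> * (c l * H l)"
      by (simp add: algebra_simps add_divide_distrib diff_divide_distrib)
  qed
  also have "\<dots> = (2 - 1 / \<epsilon>) * (\<Sum>l<p. c l * (real l * H (l - 1)))
      - (\<Sum>l<p. c l * H (Suc l) / (2 * \<epsilon>)) + \<xi> / \<epsilon> * (\<Sum>l<p. c l * H l)"
    by (simp add: sum.distrib sum_subtractf sum_distrib_left)
  also have "\<dots> = (2 - 1 / \<epsilon>) * c 1 + \<xi> / \<epsilon> * c 0 - (\<Sum>l<p. a (Suc l) * H (Suc l))"
  proof -
    have "(\<Sum>l<p. a (Suc l) * H (Suc l)) = (\<Sum>l<p. c l * H (Suc l) / (2 * \<epsilon>)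
        - (2 - 1 / \<epsilon>) * (c (l + 2) * (real l + 2) * H (Suc l)) - \<xi> / \<epsilon> * (c (Suc l) * H (Suc l)))"
      by (intro sum.cong refl) (simp add: c_rec algebra_simps)
    then show ?thesis
      unfolding low mid by (simp add: sum_subtractf sum_distrib_left distrib_left)
  qed
  \<comment> \<open>The summand \<open>a 0\<close> of the constant cancels the degree-0 term of
    h.\<close>
  also have "\<dots> = gain_const \<epsilon> a p \<xi> - poly (\<Sum>k\<le>p. smult (a k) (hermite k)) x"
    by (simp add: gain_const_def c_def[symmetric] poly_sum H_def sum.atMost_shift)
  finally show ?thesis .
qed

section \<open>Gaussian densities multiplied by polynomials\<close>

lemma gauss_pos: "\<epsilon> > 0 \<Longrightarrow> gauss \<mu> \<epsilon> x > 0"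
  by (simp add: gauss_eq)

lemma gauss_deriv:
  assumes "\<epsilon> > 0"
  shows "(gauss \<mu> \<epsilon> has_real_derivative - ((x - \<mu>) / \<epsilon>) * gauss \<mu> \<epsilon> x) (at x)"
proof -
  have "((\<lambda>x. - ((x - \<mu>)\<^sup>2 / (2 * \<epsilon>))) has_real_derivative - ((x - \<mu>) / \<epsilon>)) (at x)"
    using assms by (auto intro!: derivative_eq_intros simp: field_simps)
  from DERIV_cmult[OF DERIV_fun_exp[OF this], of "1 / sqrt (2 * pi * \<epsilon>)"] show ?thesis
    unfolding gauss_eq[OF assms, abs_def] by (simp add: mult_ac)
qed

text \<open>Expanding about the mean reduces integrability to central moments and decay to powers of
  \<open>x - \<mu>\<close>.\<close>

lemma poly_shift_expansion:
  fixes q :: "real poly"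
  shows "\<exists>r. \<forall>x. poly q x = (\<Sum>k\<le>degree r. coeff r k * (x - \<mu>) ^ k)"
proof (intro exI allI)
  fix x
  have "poly q x = poly (q \<circ>\<^sub>p [:\<mu>, 1:]) (x - \<mu>)"
    by (simp add: poly_pcompose)
  then show "poly q x = (\<Sum>k\<le>degree (q \<circ>\<^sub>p [:\<mu>, 1:]). coeff (q \<circ>\<^sub>p [:\<mu>, 1:]) k * (x - \<mu>) ^ k)"
    by (simp only: poly_altdef)
qed

lemma integrable_poly_gauss:
  assumes "\<epsilon> > 0"
  shows "integrable lborel (\<lambda>x. poly q x * gauss \<mu> \<epsilon> x)"
proof -
  obtain r where r: "\<And>x. poly q x = (\<Sum>k\<le>degree r. coeff r k * (x - \<mu>) ^ k)"
    using poly_shift_expansion by blast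
  have "integrable lborel
      (\<lambda>x. \<Sum>k\<le>degree r. coeff r k * (normal_density \<mu> (sqrt \<epsilon>) x * (x - \<mu>) ^ k))"
    by (intro Bochner_Integration.integrable_sum integrable_mult_right integrable_normal_moment)
      (use assms in simp)
  then show ?thesis
    by (simp only: r gauss_def sum_distrib_right mult.assoc mult.commute[of "normal_density _ _ _"])
qed

lemma poly_gauss_tendsto_0:
  assumes "\<epsilon> > 0" "F = at_top \<or> F = at_bot"
  shows "((\<lambda>x. poly q x * gauss \<mu> \<epsilon> x) \<longlongrightarrow> 0) F"
proof -
  obtain r where r: "\<And>x. poly q x = (\<Sum>k\<le>degree r. coeff r k * (x - \<mu>) ^ k)"
    using poly_shift_expansion by blast
  have "((\<lambda>x. (x - \<mu>) ^ k * exp (- ((x - \<mu>)\<^sup>2 / (2 * \<epsilon>)))) \<longlongrightarrow> 0) at_top" for k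
    using assms(1) by real_asymp
  moreover have "((\<lambda>x. (x - \<mu>) ^ k * exp (- ((x - \<mu>)\<^sup>2 / (2 * \<epsilon>)))) \<longlongrightarrow> 0) at_bot" for k
    using assms(1) by real_asymp
  ultimately have lim: "((\<lambda>x. (x - \<mu>) ^ k * exp (- ((x - \<mu>)\<^sup>2 / (2 * \<epsilon>)))) \<longlongrightarrow> 0) F" for k
    using assms(2) by blast
  have "((\<lambda>x. \<Sum>k\<le>degree r. coeff r k / sqrt (2 * pi * \<epsilon>)
      * ((x - \<mu>) ^ k * exp (- ((x - \<mu>)\<^sup>2 / (2 * \<epsilon>))))) \<longlongrightarrow> 0) F"
    by (intro tendsto_null_sum tendsto_mult_right_zero lim)
  then show ?thesis
    by (simp add: r gauss_eq[OF assms(1)] sum_distrib_right sum_divide_distrib mult.assoc)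
qed

section \<open>The error function: derivative and limits\<close>

lemma erf_deriv: "(erf has_real_derivative 2 / sqrt pi * exp (- x\<^sup>2)) (at x)"
proof -
  have "((\<lambda>u. LBINT y=ereal 0..ereal u. exp (- y\<^sup>2)) has_vector_derivative exp (- x\<^sup>2))
      (at x within {- \<bar>x\<bar> - 1..\<bar>x\<bar> + 1})"
    by (rule interval_integral_FTC2) (auto intro!: continuous_intros)
  then have "((\<lambda>u. LBINT y=ereal 0..ereal u. exp (- y\<^sup>2)) has_real_derivative exp (- x\<^sup>2)) (at x)"
    by (subst (asm) at_within_Icc_at) (auto simp: has_real_derivative_iff_has_vector_derivative)
  then show ?thesis
    unfolding erf_def[abs_def] by (rule DERIV_cmult)
qed

lemma erf_minus: "erf (- x) = - erf x"
proof -
  have "(LBINT y=ereal 0..ereal (- x). exp (- y\<^sup>2)) = (LBINT y=ereal x..ereal 0. exp (- y\<^sup>2))"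
    by (subst interval_integral_reflect) simp
  also have "\<dots> = - (LBINT y=ereal 0..ereal x. exp (- y\<^sup>2))"
    by (rule interval_integral_endpoints_reverse)
  finally show ?thesis by (simp add: erf_def)
qed

lemma erf_at_top: "(erf \<longlongrightarrow> 1) at_top"
proof -
  have "((\<lambda>y. \<integral>x. indicator {..y} x *\<^sub>R (indicator {0..} x *\<^sub>R exp (- x\<^sup>2)) \<partial>lborel)
      \<longlongrightarrow> sqrt pi / 2) at_top"
    using tendsto_integral_at_top[OF sets_lborel integrable.intros[OF gaussian_moment_0]]
    by (simp only: has_bochner_integral_integral_eq[OF gaussian_moment_0])
  then have "((\<lambda>y. 2 / sqrt pi * (\<integral>x. indicator {..y} x *\<^sub>R (indicator {0..} x *\<^sub>R exp (- x\<^sup>2)) \<partial>lborel))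
      \<longlongrightarrow> 2 / sqrt pi * (sqrt pi / 2)) at_top"
    by (rule tendsto_mult_left)
  \<comment> \<open>For \<open>y \<ge> 0\<close> the two indicators together cut out the interval
    from 0 to \<open>y\<close>.\<close>
  moreover have "eventually (\<lambda>y. 2 / sqrt pi *
      (\<integral>x. indicator {..y} x *\<^sub>R (indicator {0..} x *\<^sub>R exp (- x\<^sup>2)) \<partial>lborel) = erf y) at_top"
    using eventually_ge_at_top[of 0]
  proof eventually_elim
    case (elim y)
    then show ?case
      by (auto simp: erf_def interval_integral_Icc set_lebesgue_integral_def
          intro!: Bochner_Integration.integral_cong split: split_indicator)
  qed
  ultimately show ?thesis
    by (simp add: tendsto_cong)
qed

lemma erf_at_bot: "(erf \<longlongrightarrow> - 1) at_bot"
  using tendsto_minus[OF erf_at_top]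
  by (simp add: filterlim_at_bot_mirror erf_minus)

text \<open>The scaling by \<open>sqrt (2 * \<epsilon>)\<close> matches the exponents. The factor 2
  is the total increase of \<open>erf\<close> from -1 to 1 against a density of mass one, whence the
  halves in the solution formula.\<close>

lemma erf_gauss_deriv:
  assumes "\<epsilon> > 0"
  shows "((\<lambda>x. erf ((x - \<mu>) / sqrt (2 * \<epsilon>))) has_real_derivative 2 * gauss \<mu> \<epsilon> x) (at x)"
proof -
  have "((\<lambda>x. erf ((x - \<mu>) / sqrt (2 * \<epsilon>))) has_real_derivative
      2 / sqrt pi * exp (- ((x - \<mu>) / sqrt (2 * \<epsilon>))\<^sup>2) * (1 / sqrt (2 * \<epsilon>))) (at x)"
    by (rule DERIV_chain2[OF erf_deriv],
        rule DERIV_cong[OF DERIV_cdivide[OF DERIV_diff[OF DERIV_ident DERIV_const]]]) simp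
  moreover have "2 / sqrt pi * exp (- ((x - \<mu>) / sqrt (2 * \<epsilon>))\<^sup>2) * (1 / sqrt (2 * \<epsilon>)) = 2 * gauss \<mu> \<epsilon> x"
  proof -
    have "sqrt (2 * pi * \<epsilon>) = sqrt pi * sqrt (2 * \<epsilon>)"
      by (simp add: real_sqrt_mult)
    then have "gauss \<mu> \<epsilon> x = 1 / (sqrt pi * sqrt (2 * \<epsilon>)) * exp (- ((x - \<mu>)\<^sup>2 / (2 * \<epsilon>)))"
      by (simp only: gauss_eq[OF assms])
    moreover have "((x - \<mu>) / sqrt (2 * \<epsilon>))\<^sup>2 = (x - \<mu>)\<^sup>2 / (2 * \<epsilon>)"
      using assms by (simp add: power_divide)
    ultimately show ?thesis
      by simp
  qed
  ultimately show ?thesis by simp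
qed

section \<open>Integration over the line and the flux of a single particle\<close>

lemma integral_eq_limits:
  fixes F f :: "real \<Rightarrow> real"
  assumes "\<And>x. (F has_real_derivative f x) (at x)" "\<And>x. isCont f x" "integrable lborel f"
    and "(F \<longlongrightarrow> A) at_bot" "(F \<longlongrightarrow> B) at_top"
  shows "(LBINT x. f x) = B - A"
proof -
  have "(LBINT x=-\<infinity>..\<infinity>. f x) = B - A"
    by (rule interval_integral_FTC_integrable[where F = F])
      (use assms in \<open>auto simp: has_real_derivative_iff_has_vector_derivative[symmetric]
        set_integrable_def ereal_tendsto_simps\<close>)
  then show ?thesis
    by (simp add: interval_lebesgue_integral_def set_lebesgue_integral_def)
qed

context
  fixes \<epsilon> \<xi> m :: real and a :: "nat \<Rightarrow> real" and p :: nat and h P :: "real poly"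
  assumes eps: "\<epsilon> > 0"
  defines "h \<equiv> \<Sum>k\<le>p. smult (a k) (hermite k)"
  defines "P \<equiv> \<Sum>l<p. smult (gain_coeff \<epsilon> a p \<xi> l) (hermite l)"
begin

lemma gauss_gain_poly_deriv:
  "((\<lambda>x. poly P x * gauss \<xi> \<epsilon> x) has_real_derivative
    (gain_const \<epsilon> a p \<xi> - poly h x) * gauss \<xi> \<epsilon> x) (at x)"
  unfolding gain_ode[OF eps, of a p \<xi>, folded P_def h_def, symmetric]
  by (rule DERIV_cong[OF DERIV_mult[OF poly_DERIV gauss_deriv[OF eps]]]) (simp add: algebra_simps)

lemma gain_const_eq_integral: "gain_const \<epsilon> a p \<xi> = (LBINT x. poly h x * gauss \<xi> \<epsilon> x)"
proof -
  have isCont_gauss: "isCont (gauss \<xi> \<epsilon>) x" for x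
    by (rule DERIV_isCont[OF gauss_deriv[OF eps]])
  \<comment> \<open>The constant is read as a polynomial, so that the integrability result for
    polynomials covers it.\<close>
  have "integrable lborel (\<lambda>x. poly [:gain_const \<epsilon> a p \<xi>:] x * gauss \<xi> \<epsilon> x)"
    by (rule integrable_poly_gauss[OF eps])
  then have int_const: "integrable lborel (\<lambda>x. gain_const \<epsilon> a p \<xi> * gauss \<xi> \<epsilon> x)"
    by simp
  \<comment> \<open>The two zeros are the limits of the antiderivative
    \<open>poly P x * gauss \<xi> \<epsilon> x\<close> at the ends.\<close>
  have "(LBINT x. (gain_const \<epsilon> a p \<xi> - poly h x) * gauss \<xi> \<epsilon> x) = 0 - 0"
    by (rule integral_eq_limits[OF gauss_gain_poly_deriv])
      (auto intro!: continuous_intros isCont_gauss poly_gauss_tendsto_0 eps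
        int_const integrable_poly_gauss simp: left_diff_distrib)
  moreover have "(LBINT x. gauss \<xi> \<epsilon> x) = 1"
    unfolding gauss_def using eps by (intro integral_normal_density) simp
  moreover have "(LBINT x. (gain_const \<epsilon> a p \<xi> - poly h x) * gauss \<xi> \<epsilon> x) =
      gain_const \<epsilon> a p \<xi> * (LBINT x. gauss \<xi> \<epsilon> x) - (LBINT x. poly h x * gauss \<xi> \<epsilon> x)"
    unfolding left_diff_distrib
    by (subst Bochner_Integration.integral_diff[OF int_const integrable_poly_gauss[OF eps]]) simp
  ultimately show ?thesis
    by simp
qed

text \<open>One particle's share of density times gain, up to the factor 1/N. The \<open>erf\<close>
  term replaces the constant by \<open>m\<close> in the derivative; \<open>m\<close> stays arbitrary
  until the particle mean is inserted.\<close>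

definition flux :: "real \<Rightarrow> real" where
  "flux x = poly P x * gauss \<xi> \<epsilon> x + (m - gain_const \<epsilon> a p \<xi>) / 2 * erf ((x - \<xi>) / sqrt (2 * \<epsilon>))"

lemma flux_deriv: "(flux has_real_derivative - (poly h x - m) * gauss \<xi> \<epsilon> x) (at x)"
  unfolding flux_def[abs_def]
  by (rule DERIV_cong[OF DERIV_add[OF gauss_gain_poly_deriv DERIV_cmult[OF erf_gauss_deriv[OF eps]]]])
    (simp add: algebra_simps diff_divide_distrib)

text \<open>The polynomial part decays, and only the \<open>erf\<close> term survives. A single flux
  need not vanish at infinity; the sum over the particles will.\<close>

lemma flux_at_top: "(flux \<longlongrightarrow> (m - gain_const \<epsilon> a p \<xi>) / 2) at_top"
proof -
  have "filterlim (\<lambda>x. (x - \<xi>) / sqrt (2 * \<epsilon>)) at_top at_top"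
    using eps by real_asymp
  from filterlim_compose[OF erf_at_top this]
  have "(flux \<longlongrightarrow> 0 + (m - gain_const \<epsilon> a p \<xi>) / 2 * 1) at_top"
    unfolding flux_def[abs_def] by (intro tendsto_intros poly_gauss_tendsto_0 eps) auto
  then show ?thesis by simp
qed

lemma flux_at_bot: "(flux \<longlongrightarrow> - ((m - gain_const \<epsilon> a p \<xi>) / 2)) at_bot"
proof -
  have "filterlim (\<lambda>x. (x - \<xi>) / sqrt (2 * \<epsilon>)) at_bot at_bot"
    using eps by real_asymp
  from filterlim_compose[OF erf_at_bot this]
  have "(flux \<longlongrightarrow> 0 + (m - gain_const \<epsilon> a p \<xi>) / 2 * (- 1)) at_bot"
    unfolding flux_def[abs_def] by (intro tendsto_intros poly_gauss_tendsto_0 eps) auto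
  then show ?thesis by simp
qed

end

section \<open>The particle mixture: mean, uniqueness and superposition\<close>

lemma particle_density_pos:
  assumes "N \<ge> 1" "\<epsilon> > 0"
  shows "particle_density N X \<epsilon> x > 0"
  using assms by (auto simp: particle_density_def intro!: divide_pos_pos sum_pos gauss_pos)

lemma particle_mean_eq:
  assumes "\<epsilon> > 0"
  shows "particle_mean N X \<epsilon> h = (\<Sum>i = 1..N. (LBINT x. poly h x * gauss (X i) \<epsilon> x)) / real N"
proof -
  have "particle_mean N X \<epsilon> h = (LBINT x. (\<Sum>i = 1..N. poly h x * gauss (X i) \<epsilon> x) / real N)"
    by (simp add: particle_mean_def particle_density_def sum_distrib_left sum_divide_distrib)
  also have "\<dots> = (LBINT x. (\<Sum>i = 1..N. poly h x * gauss (X i) \<epsilon> x)) / real N"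
    by (rule integral_divide_zero)
  also have "\<dots> = (\<Sum>i = 1..N. (LBINT x. poly h x * gauss (X i) \<epsilon> x)) / real N"
    by (subst Bochner_Integration.integral_sum) (auto intro: integrable_poly_gauss assms)
  finally show ?thesis .
qed

lemma solves_gain_bvp_unique:
  assumes "N \<ge> 1" "\<epsilon> > 0" "solves_gain_bvp N X \<epsilon> h K" "solves_gain_bvp N X \<epsilon> h L"
  shows "K = L"
proof
  fix x
  let ?D = "\<lambda>y. particle_density N X \<epsilon> y * K y - particle_density N X \<epsilon> y * L y"
  have deriv: "((\<lambda>y. particle_density N X \<epsilon> y * M y) has_real_derivative
      - (poly h y - particle_mean N X \<epsilon> h) * particle_density N X \<epsilon> y) (at y)"
    if "solves_gain_bvp N X \<epsilon> h M" for M y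
    using that unfolding solves_gain_bvp_def by blast
  have "(?D has_real_derivative 0) (at y)" for y
    by (rule DERIV_cong[OF DERIV_diff[OF deriv[OF assms(3)] deriv[OF assms(4)]]]) simp
  then have const: "?D x = ?D y" for y
    using DERIV_isconst_all[of ?D] by blast
  \<comment> \<open>A constant function tends to its own value, which must therefore be the limit 0
    given by the boundary condition.\<close>
  have "(?D \<longlongrightarrow> ?D x) at_top"
    by (rule tendsto_eventually, rule always_eventually) (rule allI, rule const[symmetric])
  moreover have "(?D \<longlongrightarrow> 0 - 0) at_top"
    using assms(3,4) unfolding solves_gain_bvp_def by (intro tendsto_diff) auto
  ultimately have "?D x = 0 - 0"
    by (rule tendsto_unique[OF trivial_limit_at_top_linorder])
  \<comment> \<open>Positivity allows the density to be cancelled.\<close>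
  with particle_density_pos[OF assms(1,2), of X x] show "K x = L x"
    by simp
qed

theorem mainTheorem2:
  fixes N p :: nat and X a :: "nat \<Rightarrow> real" and \<epsilon> :: real
    and h :: "real poly" and K :: "real \<Rightarrow> real"
  assumes "N \<ge> 1" and "\<epsilon> > 0" and "p \<ge> 1"
    and "h = (\<Sum>k = 0..p. smult (a k) (hermite k))"
    and "degree h = p"
  shows "solves_gain_bvp N X \<epsilon> h K \<longleftrightarrow>
    K = (\<lambda>x. 1 / (\<Sum>i = 1..N. gauss (X i) \<epsilon> x) *
          (\<Sum>i = 1..N.
             gauss (X i) \<epsilon> x *
               (\<Sum>l = 0..p - 1. gain_coeff \<epsilon> a p (X i) l * poly (hermite l) x)
             + (particle_mean N X \<epsilon> h - gain_const \<epsilon> a p (X i)) / 2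
               * erf ((x - X i) / sqrt (2 * \<epsilon>))))"
    (is "_ \<longleftrightarrow> K = ?K")
proof -
  let ?m = "particle_mean N X \<epsilon> h"
  let ?C = "\<lambda>i. gain_const \<epsilon> a p (X i)"
  define F where "F i = flux \<epsilon> (X i) ?m a p" for i
  have h: "(\<Sum>k\<le>p. smult (a k) (hermite k)) = h"
    using assms(4) by (simp add: atMost_atLeast0)
  \<comment> \<open>For \<open>p = 0\<close> truncated subtraction would leave the index 0 on the
    left.\<close>
  have p: "{0..p - 1} = {..<p}"
    using \<open>p \<ge> 1\<close> by auto
  \<comment> \<open>The sum of Gaussians in the density cancels the denominator of
    \<open>?K\<close>, leaving the average of the fluxes.\<close>
  have "particle_density N X \<epsilon> x * ?K x = (\<Sum>i = 1..N. F i x) / real N" for x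
  proof -
    have "(\<Sum>i = 1..N. gauss (X i) \<epsilon> x) > 0"
      using assms(1,2) by (auto intro!: sum_pos gauss_pos)
    then show ?thesis
      by (simp add: particle_density_def F_def flux_def[OF assms(2)] p[simplified] poly_sum mult.commute)
  qed
  then have eq: "(\<lambda>x. particle_density N X \<epsilon> x * ?K x) = (\<lambda>x. (\<Sum>i = 1..N. F i x) / real N)"
    by blast
  have sum_C: "(\<Sum>i = 1..N. (?m - ?C i) / 2) = 0"
  proof -
    \<comment> \<open>By linearity the particle mean averages the integrals of h against each
      Gaussian, and these are the constants.\<close>
    have "?m = (\<Sum>i = 1..N. ?C i) / real N"
      by (simp add: particle_mean_eq[OF assms(2)] gain_const_eq_integral[OF assms(2)] h)
    then show ?thesis
      using \<open>N \<ge> 1\<close> by (simp add: sum_divide_distrib[symmetric] sum_subtractf)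
  qed
  have "solves_gain_bvp N X \<epsilon> h ?K"
    unfolding solves_gain_bvp_def eq
  proof (intro conjI allI)
    fix x
    have "((\<lambda>x. (\<Sum>i = 1..N. F i x) / real N) has_real_derivative
        (\<Sum>i = 1..N. - (poly h x - ?m) * gauss (X i) \<epsilon> x) / real N) (at x)"
      unfolding F_def
      by (intro DERIV_cdivide DERIV_sum flux_deriv[OF assms(2), where a = a and p = p, unfolded h])
    then show "((\<lambda>x. (\<Sum>i = 1..N. F i x) / real N) has_real_derivative
        - (poly h x - ?m) * particle_density N X \<epsilon> x) (at x)"
      by (simp only: particle_density_def sum_distrib_left[symmetric]) simp
  next
    have "((\<lambda>x. (\<Sum>i = 1..N. F i x) / real N) \<longlongrightarrow> (\<Sum>i = 1..N. - ((?m - ?C i) / 2)) / real N) at_bot"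
      unfolding F_def divide_inverse
      by (intro tendsto_mult_right tendsto_sum flux_at_bot[OF assms(2), unfolded divide_inverse])
    then show "((\<lambda>x. (\<Sum>i = 1..N. F i x) / real N) \<longlongrightarrow> 0) at_bot"
      by (simp only: sum_negf sum_C) simp
  next
    have "((\<lambda>x. (\<Sum>i = 1..N. F i x) / real N) \<longlongrightarrow> (\<Sum>i = 1..N. (?m - ?C i) / 2) / real N) at_top"
      unfolding F_def divide_inverse
      by (intro tendsto_mult_right tendsto_sum flux_at_top[OF assms(2), unfolded divide_inverse])
    then show "((\<lambda>x. (\<Sum>i = 1..N. F i x) / real N) \<longlongrightarrow> 0) at_top"
      by (simp only: sum_C) simp
  qed
  \<comment> \<open>Existence gives the direction from right to left, uniqueness the
    converse.\<close>
  then show ?thesis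
    using solves_gain_bvp_unique[OF assms(1,2)] by blast
qed

end
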